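(* For any positive integer $n$, $$\sum_{\pi\in\mathcal D_{2n+1}}(-1)^{\ell_D(\pi)}t^{\mathrm{ddes}(\pi)} = (1-t^2)^n\sum_{\pi\in\mathcal D_{n+1}}t^{\mathrm{ddes}(\pi)}.$$
   Context: For $N\ge1$, $\mathcal B_N$ is the group of signed permutations: words $\pi=\pi_1\cdots\pi_N$ with $\pi_i\in\{\pm1,\dots,\pm N\}$ such that $|\pi_1|\cdots|\pi_N|$ is a permutation of $\{1,\dots,N\}$; $\mathcal D_N\subseteq\mathcal B_N$ is the subgroup of those $\pi$ with an even number of negative entries. Write $\bar i=-i$. Type $D$ length: $\ell_D(\pi)=\mathrm{inv}(\pi)-\sum_{i:\,\pi_i<0}(\pi_i+1)$, where $\mathrm{inv}(\pi)=|\{(i,j):i<j,\ \pi_i>\pi_j\}|$ in the natural order of integers. For $\pi\in\mathcal B_N$, the flag descent number is $\mathrm{fdes}(\pi)=2\,\mathrm{des}_F(\pi)+\delta(\pi_1<0)$, where $\mathrm{des}_F(\pi)=|\{i\in\{1,\dots,N-1\}:\pi_i>\pi_{i+1}\}|$ with respect to the linear order $\bar1<\bar2<\cdots<\bar N<1<2<\cdots<N$, and $\delta(\mathsf A)=1$ if $\mathsf A$ is true and $0$ otherwise. For $\pi\in\mathcal D_N$, $\mathrm{ddes}(\pi)=\mathrm{fdes}(\pi_1\pi_2\cdots\pi_{N-1}|\pi_N|)$, where $\mathrm{fdes}$ is computed in $\mathcal B_N$. $t$ is an indeterminate. *)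

theory Defs
  imports "HOL-Computational_Algebra.Polynomial"
begin

(* The word w_1 ... w_N is the list w, so the letter w_i is w ! (i - 1). *)

definition signed_perms :: "nat \<Rightarrow> int list set" where
  "signed_perms N = {w. length w = N \<and> distinct (map abs w) \<and> set (map abs w) = {1..int N}}"

definition even_signed_perms :: "nat \<Rightarrow> int list set" where
  "even_signed_perms N =
     {w \<in> signed_perms N. even (card {i. i < length w \<and> w ! i < 0})}"

definition inversions :: "int list \<Rightarrow> nat" where
  "inversions w = card {(i, j). i < j \<and> j < length w \<and> w ! i > w ! j}"

definition length_D :: "int list \<Rightarrow> int" where
  "length_D w = int (inversions w) - (\<Sum>i | i < length w \<and> w ! i < 0. w ! i + 1)"

(* The strict linear order -1 < -2 < ... < -N < 1 < 2 < ... < N. *)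
definition less_F :: "int \<Rightarrow> int \<Rightarrow> bool" where
  "less_F a b \<longleftrightarrow> a < 0 \<and> b > 0 \<or> a < 0 \<and> b < 0 \<and> b < a \<or> a > 0 \<and> b > 0 \<and> a < b"

definition des_F :: "int list \<Rightarrow> nat" where
  "des_F w = card {i. Suc i < length w \<and> less_F (w ! Suc i) (w ! i)}"

definition fdes :: "int list \<Rightarrow> nat" where
  "fdes w = 2 * des_F w + (if hd w < 0 then 1 else 0)"

definition ddes :: "int list \<Rightarrow> nat" where
  "ddes w = fdes (butlast w @ [\<bar>last w\<bar>])"

(* The sums over these sets are therefore not degenerate. *)
lemma finite_signed_perms: "finite (signed_perms N)"
proof (rule finite_subset)
  show "signed_perms N \<subseteq> {w. set w \<subseteq> {- int N..int N} \<and> length w = N}"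
  proof safe
    fix w x assume w: "w \<in> signed_perms N" and "x \<in> set w"
    then have "\<bar>x\<bar> \<in> {1..int N}" unfolding signed_perms_def by auto
    then show "x \<in> {- int N..int N}" by auto
  qed (simp add: signed_perms_def)
qed (simp add: finite_lists_length_eq)

lemma finite_even_signed_perms: "finite (even_signed_perms N)"
  by (simp add: even_signed_perms_def finite_signed_perms)

(* Taking nat of length_D, so as to use it as an exponent, loses nothing. *)
lemma length_D_nonneg: "length_D w \<ge> 0"
proof -
  have "(\<Sum>i | i < length w \<and> w ! i < 0. w ! i + 1) \<le> 0"
    by (rule sum_nonpos) auto
  then show ?thesis by (simp add: length_D_def)
qed

end

theory Submission
  imports Defs
begin

text \<open>
  The sign \<open>(-1) ^ length_D w\<close> is the sign of the permutation \<open>|w|\<close> obtained by forgetting the signs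
  of the letters (\<open>sign_length_D\<close>), and \<open>ddes\<close> does not see the sign of the last letter. Making the
  last letter positive therefore turns both sums into sums over the words of \<open>B_N\<close> with positive
  last letter, weighted by the sign of \<open>|w|\<close> (or by 1) and by \<open>t ^ fdes w\<close>
  (\<open>sum_even_signed_perms\<close>).

  Exchange the absolute values \<open>a\<close> and \<open>a + 1\<close> in a word, keeping the sign at each position. This
  reverses the sign of \<open>|w|\<close>. The order used for descents puts all negative letters below all
  positive ones and compares letters of equal sign by absolute value, so the descents stay where
  they are, unless \<open>a\<close> and \<open>a + 1\<close> stand next to each other with the same sign. All other words cancel in
  pairs. A surviving pair of words arises from a word with one letter fewer by doubling the letter of
  absolute value \<open>a\<close> and relabelling the larger ones; the two orders of the doubled letter contribute
  \<open>1\<close> and \<open>- t\<^sup>2\<close>, because reversing it costs one descent and one sign. Neither the sign nor the descents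
  of the rest of the word depend on this block: the block has an even number of letters, so carrying
  it past another letter does not change the sign.

  Hence collapsing a pair gives a factor \<open>1 - t\<^sup>2\<close> and a single letter that no longer takes part in
  the sign (\<open>low_sum_step\<close>). Starting from \<open>2 n + 1\<close> letters and collapsing \<open>(2 n, 2 n + 1)\<close>,
  \<open>(2 n - 2, 2 n - 1)\<close>, ..., \<open>(2, 3)\<close> leaves words with \<open>n + 1\<close> letters of which only the letter
  1 is still counted by the sign, and one letter has no inversions.
\<close>

section \<open>Descents and inversions by recursion on words\<close>

fun descents :: "int list \<Rightarrow> nat" where
  "descents (x # y # zs) = of_bool (less_F y x) + descents (y # zs)"
| "descents _ = 0"

lemma des_F_eq_descents: "des_F w = descents w"
proof (induction w rule: descents.induct)
  case (1 x y zs)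
  let ?A = "\<lambda>w. {i. Suc i < length w \<and> less_F (w ! Suc i) (w ! i)}"
  have fin: "finite (?A (y # zs))" by simp
  have "?A (x # y # zs) = (if less_F y x then {0} else {}) \<union> Suc ` ?A (y # zs)"
  proof (rule set_eqI)
    show "i \<in> ?A (x # y # zs) \<longleftrightarrow> i \<in> (if less_F y x then {0} else {}) \<union> Suc ` ?A (y # zs)" for i
      by (cases i) (auto simp: image_iff)
  qed
  moreover have "card (Suc ` ?A (y # zs)) = card (?A (y # zs))"
    by (rule card_image) simp
  ultimately have "card (?A (x # y # zs)) = of_bool (less_F y x) + card (?A (y # zs))"
    using fin by (auto simp: card_insert_if)
  then show ?case using 1 by (simp add: des_F_def)
qed (simp_all add: des_F_def)

lemma fdes_eq: "fdes w = 2 * descents w + of_bool (hd w < 0)"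
  by (simp add: fdes_def des_F_eq_descents)

fun inv_count :: "int list \<Rightarrow> nat" where
  "inv_count [] = 0"
| "inv_count (x # xs) = length (filter (\<lambda>y. y < x) xs) + inv_count xs"

lemma inversions_eq_inv_count: "inversions w = inv_count w"
proof (induction w)
  case (Cons x xs)
  let ?A = "\<lambda>w::int list. {(i, j). i < j \<and> j < length w \<and> w ! i > w ! j}"
  let ?B = "{j. j < length xs \<and> xs ! j < x}"
  have fin: "finite (?A xs)"
    by (rule finite_subset[of _ "{..<length xs} \<times> {..<length xs}"]) auto
  have "?A (x # xs) = (\<lambda>j. (0, Suc j)) ` ?B \<union> map_prod Suc Suc ` ?A xs"
  proof (rule set_eqI)
    fix p :: "nat \<times> nat"
    obtain i j where p: "p = (i, j)" by fastforce
    show "p \<in> ?A (x # xs) \<longleftrightarrow> p \<in> (\<lambda>j. (0, Suc j)) ` ?B \<union> map_prod Suc Suc ` ?A xs"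
      unfolding p by (cases i; cases j) (auto simp: image_iff)
  qed
  moreover have "card ((\<lambda>j. (0::nat, Suc j)) ` ?B \<union> map_prod Suc Suc ` ?A xs)
      = card ((\<lambda>j. (0::nat, Suc j)) ` ?B) + card (map_prod Suc Suc ` ?A xs)"
    by (rule card_Un_disjoint) (use fin in auto)
  moreover have "card ((\<lambda>j. (0::nat, Suc j)) ` ?B) = card ?B"
    by (rule card_image) (auto simp: inj_on_def)
  moreover have "card (map_prod Suc Suc ` ?A xs) = card (?A xs)"
    by (rule card_image) (auto simp: inj_on_def)
  ultimately have "card (?A (x # xs)) = card ?B + card (?A xs)" by simp
  then show ?case using Cons
    by (simp add: inversions_def length_filter_conv_card)
qed (simp add: inversions_def)

section \<open>The sign of the type D length\<close>

text \<open>
  The contribution of a single pair of letters to \<open>parity_inv_count_abs\<close>, with \<open>x\<close> standing before \<open>y\<close>: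
  changing the sign of the letter of larger absolute value reverses the order of the pair, while
  changing that of the smaller one does not.
\<close>

lemma parity_letter:
  fixes p q x y :: int
  assumes "p > 0" and "q > 0" and "p \<noteq> q" and "x = p \<or> x = - p" and "y = q \<or> y = - q"
  shows "even (of_bool (y < x) + of_bool (q < p) + of_bool (x < 0 \<and> q < p)
      + of_bool (y < 0 \<and> p < q) :: nat)"
  using assms by (cases "p < q") auto

text \<open>
  Forgetting the signs changes the inversion number by one, modulo 2, for each negative letter and
  each letter of smaller absolute value. In a signed permutation there are \<open>\<bar>x\<bar> - 1\<close> letters of
  absolute value smaller than \<open>\<bar>x\<bar>\<close>, which is what \<open>length_D\<close> adds for \<open>x < 0\<close>.
\<close>

lemma parity_inv_count_abs:
  assumes "distinct (map abs w)" and "0 \<notin> set w"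
  shows "even (inv_count w + inv_count (map abs w)
    + sum_list (map (\<lambda>x. length (filter (\<lambda>y. \<bar>y\<bar> < \<bar>x\<bar>) w)) (filter (\<lambda>x. x < 0) w)))"
  using assms
proof (induction w)
  case (Cons x xs)
  define smaller where
    "smaller = (\<lambda>(w :: int list) (z :: int). length (filter (\<lambda>y. \<bar>y\<bar> < \<bar>z\<bar>) w))"
  let ?neg = "filter (\<lambda>z. z < 0)"
  let ?S = "sum_list (map (smaller xs) (?neg xs))"
  let ?above = "length (filter (\<lambda>y. y < 0 \<and> \<bar>x\<bar> < \<bar>y\<bar>) xs)"
  have "sum_list (map (smaller (x # vs)) (?neg us))
      = sum_list (map (smaller vs) (?neg us)) + length (filter (\<lambda>y. y < 0 \<and> \<bar>x\<bar> < \<bar>y\<bar>) us)"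
    for us vs
    by (induction us) (auto simp: smaller_def)
  then have split: "sum_list (map (smaller (x # xs)) (?neg xs)) = ?S + ?above" .
  have "smaller (x # xs) x = smaller xs x" by (simp add: smaller_def)
  with split have sum: "sum_list (map (smaller (x # xs)) (?neg (x # xs)))
      = ?S + ?above + (if x < 0 then smaller xs x else 0)"
    by simp
  have new: "even (length (filter (\<lambda>y. y < x) xs) + length (filter (\<lambda>y. y < \<bar>x\<bar>) (map abs xs))
      + (if x < 0 then smaller xs x else 0) + ?above)"
  proof -
    have letter: "even (of_bool (y < x) + of_bool (\<bar>y\<bar> < \<bar>x\<bar>) + of_bool (x < 0 \<and> \<bar>y\<bar> < \<bar>x\<bar>)
        + of_bool (y < 0 \<and> \<bar>x\<bar> < \<bar>y\<bar>) :: nat)" if "y \<in> set xs" for y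
    proof -
      have "\<bar>x\<bar> \<notin> abs ` set xs" using Cons.prems(1) by simp
      then have "\<bar>x\<bar> \<noteq> \<bar>y\<bar>" using that by (metis imageI)
      moreover have "x \<noteq> 0" "y \<noteq> 0" using that Cons.prems(2) by (metis list.set_intros)+
      ultimately show ?thesis
        using parity_letter[of "\<bar>x\<bar>" "\<bar>y\<bar>" x y] by linarith
    qed
    have "even (sum_list (map f us))" if "\<forall>y \<in> set us. even (f y)" for f :: "int \<Rightarrow> nat" and us
      using that by (induction us) simp_all
    then have "even (\<Sum>y\<leftarrow>xs. of_bool (y < x) + of_bool (\<bar>y\<bar> < \<bar>x\<bar>)
        + of_bool (x < 0 \<and> \<bar>y\<bar> < \<bar>x\<bar>) + of_bool (y < 0 \<and> \<bar>x\<bar> < \<bar>y\<bar>) :: nat)"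
      using letter by simp
    moreover have count: "length (filter P us) = (\<Sum>y\<leftarrow>us. of_bool (P y))" for P and us :: "int list"
      by (induction us) simp_all
    ultimately show ?thesis
      by (cases "x < 0") (simp_all add: smaller_def count sum_list_addf o_def)
  qed
  have IH: "even (inv_count xs + inv_count (map abs xs) + ?S)"
    using Cons.IH Cons.prems unfolding smaller_def by simp
  have total: "inv_count (x # xs) + inv_count (map abs (x # xs))
      + sum_list (map (smaller (x # xs)) (?neg (x # xs)))
    = (inv_count xs + inv_count (map abs xs) + ?S)
    + (length (filter (\<lambda>y. y < x) xs) + length (filter (\<lambda>y. y < \<bar>x\<bar>) (map abs xs))
      + (if x < 0 then smaller xs x else 0) + ?above)"
    unfolding sum by simp
  have "even (inv_count (x # xs) + inv_count (map abs (x # xs))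
      + sum_list (map (smaller (x # xs)) (?neg (x # xs))))"
    unfolding total by (rule dvd_add[OF IH new])
  then show ?case unfolding smaller_def .
qed simp

lemma signed_perms_iff:
  "w \<in> signed_perms N \<longleftrightarrow> length w = N \<and> abs ` set w = {1..int N}"
proof -
  have "distinct (map abs w)" if "length w = N" "abs ` set w = {1..int N}"
    using that by (intro card_distinct) simp
  then show ?thesis by (auto simp: signed_perms_def)
qed

lemma sum_over_negative_positions:
  "(\<Sum>i | i < length w \<and> w ! i < 0. f (w ! i)) = sum_list (map f (filter (\<lambda>x. x < (0::int)) w))"
  for f :: "int \<Rightarrow> int"
proof -
  have "sum_list (map f (filter (\<lambda>x. x < 0) w)) = sum_list (map (\<lambda>x. if x < 0 then f x else 0) w)"
    by (simp add: sum_list_map_filter')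
  also have "\<dots> = (\<Sum>i<length w. if w ! i < 0 then f (w ! i) else 0)"
    by (simp add: sum_list_sum_nth atLeast0LessThan)
  also have "\<dots> = (\<Sum>i | i < length w \<and> w ! i < 0. f (w ! i))"
    by (simp add: sum.inter_filter[symmetric])
  finally show ?thesis by simp
qed

lemma sign_length_D:
  assumes "w \<in> signed_perms N"
  shows "(-1) ^ nat (length_D w) = ((-1) ^ inv_count (map abs w) :: 'a::comm_ring_1)"
proof -
  have w: "distinct (map abs w)" "abs ` set w = {1..int N}"
    using assms by (auto simp: signed_perms_def)
  have smaller: "length (filter (\<lambda>y. \<bar>y\<bar> < \<bar>x\<bar>) w) = nat (\<bar>x\<bar> - 1)" if "x \<in> set w" for x
  proof -
    have "\<bar>x\<bar> \<in> {1..int N}" using w(2) that by blast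
    have "length (filter (\<lambda>y. \<bar>y\<bar> < \<bar>x\<bar>) w) = length (filter (\<lambda>y. y < \<bar>x\<bar>) (map abs w))"
      by (simp add: filter_map o_def)
    also have "\<dots> = card (set (filter (\<lambda>y. y < \<bar>x\<bar>) (map abs w)))"
      by (rule distinct_card[symmetric]) (use w(1) in simp)
    also have "set (filter (\<lambda>y. y < \<bar>x\<bar>) (map abs w)) = {1..int N} \<inter> {..<\<bar>x\<bar>}"
      using w(2) by auto
    also have "\<dots> = {1..<\<bar>x\<bar>}" using \<open>\<bar>x\<bar> \<in> {1..int N}\<close> by auto
    finally show ?thesis by simp
  qed
  let ?S = "sum_list (map (\<lambda>x. length (filter (\<lambda>y. \<bar>y\<bar> < \<bar>x\<bar>) w)) (filter (\<lambda>x. x < 0) w))"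
  have zero: "0 \<notin> set w"
  proof
    assume "0 \<in> set w"
    then have "\<bar>0\<bar> \<in> {1..int N}" using w(2) by blast
    then show False by simp
  qed
  have "int ?S = sum_list (map (\<lambda>x. int (length (filter (\<lambda>y. \<bar>y\<bar> < \<bar>x\<bar>) w)))
      (filter (\<lambda>x. x < 0) w))"
    by (simp add: sum_list_of_nat[symmetric] o_def)
  also have "\<dots> = sum_list (map (\<lambda>x. int (nat (\<bar>x\<bar> - 1))) (filter (\<lambda>x. x < 0) w))"
    by (intro arg_cong[where f = sum_list] map_cong refl arg_cong[where f = int] smaller) simp
  also have "\<dots> = sum_list (map (\<lambda>x. - (x + 1)) (filter (\<lambda>x. x < 0) w))"
    by (intro arg_cong[where f = sum_list] map_cong) auto
  also have "\<dots> = - (\<Sum>i | i < length w \<and> w ! i < 0. w ! i + 1)"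
    by (subst sum_over_negative_positions[symmetric]) (rule sum_negf)
  finally have "length_D w = int (inv_count w + ?S)"
    by (simp add: length_D_def inversions_eq_inv_count)
  then have "nat (length_D w) = inv_count w + ?S" by simp
  moreover have "even (inv_count w + ?S) = even (inv_count (map abs w))"
    using parity_inv_count_abs[OF w(1) zero] by (simp only: even_add) blast
  ultimately show ?thesis by (metis neg_one_even_power neg_one_odd_power)
qed

section \<open>From even signed permutations to words with positive last letter\<close>

definition last_pos_perms :: "nat \<Rightarrow> int list set" where
  "last_pos_perms N = {w \<in> signed_perms N. 0 < last w}"

lemma finite_last_pos_perms: "finite (last_pos_perms N)"
  by (simp add: last_pos_perms_def finite_signed_perms)

text \<open>
  Forgetting the sign of the last letter is a bijection from \<open>D_N\<close> to the words with positive last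
  letter, since the parity of the number of negative letters recovers it. It carries \<open>ddes\<close> to
  \<open>fdes\<close> by definition and keeps all absolute values.
\<close>

lemma sum_even_signed_perms:
  fixes t :: "'a::comm_ring_1"
  assumes "N \<ge> 1"
  shows "(\<Sum>w \<in> even_signed_perms N. h (map abs w) * t ^ ddes w)
       = (\<Sum>w \<in> last_pos_perms N. h (map abs w) * t ^ fdes w)"
proof -
  define neg where "neg = (\<lambda>w :: int list. length (filter (\<lambda>x. x < 0) w))"
  define f where "f = (\<lambda>w :: int list. butlast w @ [\<bar>last w\<bar>])"
  define g where "g = (\<lambda>w. if even (neg w) then w else butlast w @ [- last w])"
  have even_iff: "w \<in> even_signed_perms N \<longleftrightarrow> w \<in> signed_perms N \<and> even (neg w)" for w
    by (simp add: even_signed_perms_def neg_def length_filter_conv_card)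
  have snoc: "\<exists>u x. w = u @ [x] \<and> x \<noteq> 0" if "w \<in> signed_perms N" for w
  proof -
    have "w \<noteq> []" using that assms by (auto simp: signed_perms_def)
    then obtain u x where ux: "w = u @ [x]" by (metis append_butlast_last_id)
    then have "\<bar>x\<bar> \<in> {1..int N}" using that by (auto simp: signed_perms_iff)
    then show ?thesis using ux by auto
  qed
  have sgn_last: "u @ [y] \<in> signed_perms N" if "u @ [x] \<in> signed_perms N" "\<bar>y\<bar> = \<bar>x\<bar>" for u x y
    using that by (auto simp: signed_perms_iff)
  show ?thesis
  proof (rule sum.reindex_bij_witness[of _ g f])
    fix w assume w: "w \<in> even_signed_perms N"
    then obtain u x where ux: "w = u @ [x]" "x \<noteq> 0" using snoc even_iff by blast
    show "g (f w) = w"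
      using w ux unfolding even_iff f_def g_def neg_def by (auto simp: abs_if)
    show "f w \<in> last_pos_perms N"
      using w ux sgn_last[of u x "\<bar>x\<bar>"] by (auto simp: even_iff f_def last_pos_perms_def)
    show "h (map abs (f w)) * t ^ fdes (f w) = h (map abs w) * t ^ ddes w"
      using ux by (simp add: f_def ddes_def)
  next
    fix w assume w: "w \<in> last_pos_perms N"
    then obtain u x where ux: "w = u @ [x]" "x \<noteq> 0"
      using snoc[of w] by (auto simp: last_pos_perms_def)
    then have "x > 0" using w by (simp add: last_pos_perms_def)
    then show "f (g w) = w" using ux by (simp add: f_def g_def)
    show "g w \<in> even_signed_perms N"
      using w ux \<open>x > 0\<close> sgn_last[of u x "- x"]
      by (auto simp: even_iff g_def neg_def last_pos_perms_def)
  qed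
qed

section \<open>Exchanging two consecutive absolute values\<close>

definition swap_abs :: "int \<Rightarrow> int \<Rightarrow> int" where
  "swap_abs a x = (if \<bar>x\<bar> = a then sgn x * (a + 1) else if \<bar>x\<bar> = a + 1 then sgn x * a else x)"

lemma swap_abs_pos: "a \<ge> 1 \<Longrightarrow> x \<ge> 0 \<Longrightarrow>
    swap_abs a x = (if x = a then a + 1 else if x = a + 1 then a else x)"
  by (auto simp: swap_abs_def)

lemma swap_abs_neg: "a \<ge> 1 \<Longrightarrow> x \<le> 0 \<Longrightarrow>
    swap_abs a x = (if x = - a then - a - 1 else if x = - a - 1 then - a else x)"
  by (auto simp: swap_abs_def)

lemma abs_swap_abs: "a \<ge> 1 \<Longrightarrow> \<bar>swap_abs a x\<bar> = swap_abs a \<bar>x\<bar>"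
  by (cases "x \<ge> 0") (simp_all add: swap_abs_pos swap_abs_neg)

lemma swap_abs_swap_abs: "a \<ge> 1 \<Longrightarrow> swap_abs a (swap_abs a x) = x"
  by (cases "x \<ge> 0") (simp_all add: swap_abs_pos swap_abs_neg)

lemma swap_abs_less_0: "a \<ge> 1 \<Longrightarrow> swap_abs a x < 0 \<longleftrightarrow> x < 0"
  by (cases "x \<ge> 0") (simp_all add: swap_abs_pos swap_abs_neg)

lemma swap_abs_greater_0: "a \<ge> 1 \<Longrightarrow> 0 < swap_abs a x \<longleftrightarrow> 0 < x"
  by (cases "x \<ge> 0") (simp_all add: swap_abs_pos swap_abs_neg)

text \<open>
  The only pairs of letters whose relative order is changed by \<open>swap_abs a\<close>.
\<close>

definition exchanged :: "int \<Rightarrow> int \<Rightarrow> int \<Rightarrow> bool" where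
  "exchanged a x y \<longleftrightarrow> (0 < x \<longleftrightarrow> 0 < y) \<and>
     (\<bar>x\<bar> = a \<and> \<bar>y\<bar> = a + 1 \<or> \<bar>x\<bar> = a + 1 \<and> \<bar>y\<bar> = a)"

lemma less_F_swap_abs:
  assumes "a \<ge> 1" and "\<not> exchanged a x y"
  shows "less_F (swap_abs a x) (swap_abs a y) = less_F x y"
proof (cases "x \<le> 0"; cases "y \<le> 0")
  assume "x \<le> 0" "y \<le> 0"
  then show ?thesis using assms
    by (simp add: less_F_def swap_abs_neg exchanged_def) arith
next
  assume "\<not> x \<le> 0" "\<not> y \<le> 0"
  then show ?thesis using assms
    by (simp add: less_F_def swap_abs_pos exchanged_def) arith
qed (use assms(1) in \<open>auto simp: less_F_def swap_abs_less_0 swap_abs_greater_0\<close>)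

lemma descents_swap_abs_neqD:
  assumes "a \<ge> 1" and "descents (map (swap_abs a) w) \<noteq> descents w"
  shows "\<exists>u x y v. w = u @ x # y # v \<and> exchanged a x y"
  using assms(2)
proof (induction w rule: descents.induct)
  case (1 x y zs)
  show ?case
  proof (cases "exchanged a x y")
    case True
    then show ?thesis by (intro exI[of _ "[]"]) auto
  next
    case False
    then have "\<not> exchanged a y x" by (auto simp: exchanged_def)
    then have "less_F (swap_abs a y) (swap_abs a x) = less_F y x"
      by (rule less_F_swap_abs[OF assms(1)])
    then have "descents (map (swap_abs a) (y # zs)) \<noteq> descents (y # zs)"
      using "1.prems" by simp
    then obtain u x' y' v where "y # zs = u @ x' # y' # v" "exchanged a x' y' "
      using "1.IH" by blast
    then show ?thesis by (intro exI[of _ "x # u"]) auto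
  qed
qed simp_all

text \<open>
  Exchanging the values \<open>a\<close> and \<open>a + 1\<close> changes the comparison of these two values only, so the
  inversion number changes by one if both occur and not at all otherwise. The second case is what the
  induction needs once one of them has been removed from the word.
\<close>

lemma inv_count_swap_abs:
  assumes "a \<ge> 1" and "distinct p" and "\<forall>x \<in> set p. 0 < x"
  shows "even (inv_count p + inv_count (map (swap_abs a) p)) \<longleftrightarrow> \<not> (a \<in> set p \<and> a + 1 \<in> set p)"
  using assms(2,3)
proof (induction p)
  case (Cons x xs)
  define k where "k zs = length (filter (\<lambda>y. y < x) zs)
      + length (filter (\<lambda>y. y < swap_abs a x) (map (swap_abs a) zs))" for zs
  have k: "even (k xs) \<longleftrightarrow> \<not> (x = a \<and> a + 1 \<in> set xs \<or> x = a + 1 \<and> a \<in> set xs)"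
    using Cons.prems
  proof (induction xs)
    case (Cons y ys)
    have "even (of_bool (y < x) + of_bool (swap_abs a y < swap_abs a x) :: nat)
        \<longleftrightarrow> \<not> (x = a \<and> y = a + 1 \<or> x = a + 1 \<and> y = a)"
      using Cons.prems assms(1) by (auto simp: swap_abs_pos)
    moreover have "even (k ys) \<longleftrightarrow> \<not> (x = a \<and> a + 1 \<in> set ys \<or> x = a + 1 \<and> a \<in> set ys)"
      using Cons by simp
    moreover have "k (y # ys) = (of_bool (y < x) + of_bool (swap_abs a y < swap_abs a x)) + k ys"
      by (simp add: k_def)
    moreover have "\<not> (y = a + 1 \<and> a + 1 \<in> set ys)" "\<not> (y = a \<and> a \<in> set ys)"
      using Cons.prems by auto
    ultimately show ?case by (simp only: even_add list.set insert_iff) (smt (verit))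
  qed (simp add: k_def)
  have "inv_count (x # xs) + inv_count (map (swap_abs a) (x # xs))
      = k xs + (inv_count xs + inv_count (map (swap_abs a) xs))"
    by (simp add: k_def)
  moreover have "\<not> (x = a \<and> a \<in> set xs)" "\<not> (x = a + 1 \<and> a + 1 \<in> set xs)"
    using Cons.prems by auto
  moreover have "even (inv_count xs + inv_count (map (swap_abs a) xs))
      \<longleftrightarrow> \<not> (a \<in> set xs \<and> a + 1 \<in> set xs)"
    using Cons by simp
  ultimately show ?case using k by (simp only: even_add list.set insert_iff) auto
qed simp

section \<open>The sign of the small letters\<close>

text \<open>
  The exponent of the sign when only the letters of absolute value at most \<open>j\<close> count. It is what is
  left of the inversion number, modulo 2, after the pairs above \<open>j\<close> have been collapsed.
\<close>

definition low_inv :: "int \<Rightarrow> int list \<Rightarrow> nat" where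
  "low_inv j w = inv_count (filter (\<lambda>y. y \<le> j) (map abs w))"

lemma odd_low_inv_swap_abs:
  assumes "a \<ge> 1" and "distinct (map abs w)" and "0 \<notin> set w" and "{a, a + 1} \<subseteq> abs ` set w"
  shows "odd (low_inv (a + 1) w + low_inv (a + 1) (map (swap_abs a) w))"
proof -
  let ?p = "filter (\<lambda>y. y \<le> a + 1) (map abs w)"
  have pos: "\<forall>x \<in> set (map abs w). 0 < x" using assms(3) by auto
  have "filter (\<lambda>y. y \<le> a + 1) (map (swap_abs a) q) = map (swap_abs a) (filter (\<lambda>y. y \<le> a + 1) q)"
    if "\<forall>x \<in> set q. 0 < x" for q
    using that assms(1) by (induction q) (auto simp: swap_abs_pos)
  moreover have "map abs (map (swap_abs a) w) = map (swap_abs a) (map abs w)"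
    using assms(1) by (simp add: abs_swap_abs)
  ultimately have "low_inv (a + 1) (map (swap_abs a) w) = inv_count (map (swap_abs a) ?p)"
    using pos unfolding low_inv_def by metis
  moreover have "a \<in> set ?p \<and> a + 1 \<in> set ?p" using assms(4) by auto
  ultimately show ?thesis
    using inv_count_swap_abs[OF assms(1), of ?p] assms(2) pos by (auto simp: low_inv_def)
qed

section \<open>Doubling a letter\<close>

text \<open>
  The letter of absolute value \<open>a\<close> becomes an ascending block of absolute values \<open>a\<close> and \<open>a + 1\<close> with
  the same sign, and larger absolute values grow by one to make room for it; \<open>x + sgn x\<close> is the letter
  of the sign of \<open>x\<close> with the next absolute value.
\<close>

definition double_letter :: "int \<Rightarrow> int \<Rightarrow> int list" where
  "double_letter a x =
     (if \<bar>x\<bar> < a then [x] else if \<bar>x\<bar> = a then [x, x + sgn x] else [x + sgn x])"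

definition expand :: "int \<Rightarrow> int list \<Rightarrow> int list" where
  "expand a w = concat (map (double_letter a) w)"

definition squeeze :: "int \<Rightarrow> int list \<Rightarrow> int list" where
  "squeeze a w = map (\<lambda>x. if \<bar>x\<bar> > a then x - sgn x else x) (filter (\<lambda>x. \<bar>x\<bar> \<noteq> a + 1) w)"

lemma abs_add_sgn: "x \<noteq> 0 \<Longrightarrow> \<bar>x + sgn x\<bar> = \<bar>x\<bar> + 1" for x :: int
  by (cases "x > 0") simp_all

lemma map_abs_double_letter:
  "x \<noteq> 0 \<Longrightarrow> map abs (double_letter a x) =
    (if \<bar>x\<bar> < a then [\<bar>x\<bar>] else if \<bar>x\<bar> = a then [a, a + 1] else [\<bar>x\<bar> + 1])"
  by (simp add: double_letter_def abs_add_sgn)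

lemma expand_simps [simp]:
  "expand a [] = []"
  "expand a (x # xs) = double_letter a x @ expand a xs"
  "expand a (u @ v) = expand a u @ expand a v"
  by (simp_all add: expand_def)

lemma double_letter_neq_Nil [simp]: "double_letter a x \<noteq> []"
  by (simp add: double_letter_def)

lemma expand_eq_Nil_iff [simp]: "expand a w = [] \<longleftrightarrow> w = []"
  by (cases w) auto

lemma squeeze_append: "squeeze a (u @ v) = squeeze a u @ squeeze a v"
  by (simp add: squeeze_def)

lemma squeeze_expand:
  assumes "a \<ge> 1"
  shows "squeeze a (expand a w) = w"
proof (induction w)
  case (Cons x xs)
  have "squeeze a (double_letter a x) = [x]"
    using assms by (auto simp: squeeze_def double_letter_def sgn_if)
  then show ?case using Cons by (simp add: squeeze_append)
qed (simp add: squeeze_def)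

lemma expand_squeeze_id:
  assumes "a \<ge> 1" and "\<forall>z \<in> set u. \<bar>z\<bar> \<noteq> a \<and> \<bar>z\<bar> \<noteq> a + 1"
  shows "expand a (squeeze a u) = u"
  using assms(2)
proof (induction u)
  case (Cons x xs)
  then have "expand a (squeeze a [x]) = [x]"
    using assms(1) by (auto simp: squeeze_def double_letter_def sgn_if)
  then show ?case using Cons squeeze_append[of a "[x]" xs] by simp
qed (simp add: squeeze_def)

text \<open>
  A word in which \<open>a\<close> and \<open>a + 1\<close> stand next to each other in this order with the same sign is an
  expansion.
\<close>

lemma expand_squeeze_block:
  assumes "a \<ge> 1" and "\<bar>x\<bar> = a"
    and "\<forall>z \<in> set u \<union> set v. \<bar>z\<bar> \<noteq> a \<and> \<bar>z\<bar> \<noteq> a + 1"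
  shows "expand a (squeeze a (u @ x # (x + sgn x) # v)) = u @ x # (x + sgn x) # v"
proof -
  have "squeeze a (u @ [x, x + sgn x] @ v) = squeeze a u @ [x] @ squeeze a v"
    using assms(1,2) by (auto simp: squeeze_def sgn_if)
  moreover have "double_letter a x = [x, x + sgn x]"
    using assms(2) by (simp add: double_letter_def)
  ultimately show ?thesis
    using expand_squeeze_id[OF assms(1), of u] expand_squeeze_id[OF assms(1), of v] assms(3)
    by simp
qed

lemma hd_expand_less_0: "a \<ge> 1 \<Longrightarrow> w \<noteq> [] \<Longrightarrow> hd (expand a w) < 0 \<longleftrightarrow> hd w < 0"
  by (cases w) (auto simp: double_letter_def sgn_if)

lemma last_expand_greater_0: "a \<ge> 1 \<Longrightarrow> w \<noteq> [] \<Longrightarrow> 0 < last (expand a w) \<longleftrightarrow> 0 < last w"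
  by (cases w rule: rev_cases) (auto simp: double_letter_def sgn_if)

lemma less_F_double_letter:
  assumes "a \<ge> 1" and "\<bar>x\<bar> \<noteq> \<bar>y\<bar>" and "x \<noteq> 0" and "y \<noteq> 0"
  shows "less_F (hd (double_letter a y)) (last (double_letter a x)) = less_F y x"
proof -
  have "x \<noteq> y" using assms(2) by auto
  then show ?thesis using assms(1,3,4)
    by (cases "x < 0"; cases "y < 0")
      (simp_all add: double_letter_def less_F_def add1_zle_eq)
qed

text \<open>
  Exchanging \<open>a\<close> and \<open>a + 1\<close> reverses the block, so its first letter is now the larger one and its
  last letter the smaller one. Towards the neighbouring letters, none of which has absolute value
  \<open>a\<close> or \<open>a + 1\<close>, either of them behaves like the original letter.
\<close>

lemma swap_abs_double_letter:
  assumes "a \<ge> 1"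
  shows "swap_abs a (hd (double_letter a x)) = (if \<bar>x\<bar> < a then x else x + sgn x)"
    and "swap_abs a (last (double_letter a x)) = (if \<bar>x\<bar> \<le> a then x else x + sgn x)"
proof -
  have "swap_abs a (hd (double_letter a x)) = (if \<bar>x\<bar> < a then x else x + sgn x)
      \<and> swap_abs a (last (double_letter a x)) = (if \<bar>x\<bar> \<le> a then x else x + sgn x)"
  proof (cases "x \<ge> 0")
    case True
    then show ?thesis using assms by (simp add: double_letter_def swap_abs_pos)
  next
    case False
    then show ?thesis using assms by (simp add: double_letter_def swap_abs_neg)
  qed
  then show "swap_abs a (hd (double_letter a x)) = (if \<bar>x\<bar> < a then x else x + sgn x)"
    and "swap_abs a (last (double_letter a x)) = (if \<bar>x\<bar> \<le> a then x else x + sgn x)"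
    by blast+
qed

lemma less_F_swap_double_letter:
  assumes "a \<ge> 1" and "\<bar>x\<bar> \<noteq> \<bar>y\<bar>" and "x \<noteq> 0" and "y \<noteq> 0"
  shows "less_F (swap_abs a (hd (double_letter a y))) (swap_abs a (last (double_letter a x)))
    = less_F y x"
proof -
  have "x \<noteq> y" using assms(2) by auto
  then show ?thesis unfolding swap_abs_double_letter[OF assms(1)] using assms(1,3,4)
    by (cases "x < 0"; cases "y < 0") (simp_all add: less_F_def add1_zle_eq)
qed

lemma descents_double_letter_append:
  assumes "a \<ge> 1"
  shows "descents (double_letter a x @ w) =
    (if w = [] then 0 else of_bool (less_F (hd w) (last (double_letter a x)))) + descents w"
proof (cases "\<bar>x\<bar> = a")
  case True
  moreover have "\<not> less_F (x + sgn x) x"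
    using True assms by (cases "x < 0") (simp_all add: less_F_def)
  ultimately show ?thesis by (cases w) (auto simp: double_letter_def)
next
  case False
  then show ?thesis by (cases w) (auto simp: double_letter_def)
qed

lemma descents_swap_double_letter_append:
  assumes "a \<ge> 1"
  shows "descents (map (swap_abs a) (double_letter a x) @ w) = of_bool (\<bar>x\<bar> = a) +
    (if w = [] then 0 else of_bool (less_F (hd w) (swap_abs a (last (double_letter a x)))))
    + descents w"
proof (cases "\<bar>x\<bar> = a")
  case True
  moreover have "swap_abs a (x + sgn x) = x" "swap_abs a x = x + sgn x" "less_F x (x + sgn x)"
    using True assms by (auto simp: swap_abs_def sgn_if less_F_def)
  ultimately show ?thesis by (cases w) (auto simp: double_letter_def)
next
  case False
  then show ?thesis by (cases w) (auto simp: double_letter_def)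
qed

text \<open>
  The block is ascending, and its letters compare with the other letters like the letter that they
  replace.
\<close>

lemma descents_expand:
  assumes "a \<ge> 1" and "distinct (map abs w)" and "0 \<notin> set w"
  shows "descents (expand a w) = descents w"
  using assms(2,3)
proof (induction w rule: descents.induct)
  case (1 x y zs)
  let ?r = "expand a (y # zs)"
  have "descents (double_letter a x @ ?r)
      = of_bool (less_F (hd ?r) (last (double_letter a x))) + descents ?r"
    using "1.prems" descents_double_letter_append[OF assms(1), of x ?r] by simp
  moreover have "less_F (hd ?r) (last (double_letter a x)) = less_F y x"
    using "1.prems" less_F_double_letter[OF assms(1), of x y] by simp
  ultimately show ?case using 1 by simp
next
  case ("2_2" x)
  then show ?case using descents_double_letter_append[OF assms(1), of x "[]"] by simp
qed simp

text \<open>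
  The reversed block has one descent inside.
\<close>

lemma descents_swap_expand:
  assumes "a \<ge> 1" and "distinct (map abs w)" and "0 \<notin> set w"
  shows "descents (map (swap_abs a) (expand a w)) = descents w + of_bool (a \<in> abs ` set w)"
  using assms(2,3)
proof (induction w rule: descents.induct)
  case (1 x y zs)
  let ?r = "map (swap_abs a) (expand a (y # zs))" and ?d = "map (swap_abs a) (double_letter a x)"
  have "descents (?d @ ?r) = of_bool (\<bar>x\<bar> = a) + of_bool (less_F (hd ?r) (last ?d)) + descents ?r"
    using "1.prems" descents_swap_double_letter_append[OF assms(1), of x ?r]
    by (simp add: last_map)
  moreover have "less_F (hd ?r) (last ?d) = less_F y x"
    using "1.prems" less_F_swap_double_letter[OF assms(1), of x y]
    by (simp add: hd_map last_map hd_append)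
  moreover have "descents ?r = descents (y # zs) + of_bool (a \<in> abs ` set (y # zs))"
    using 1 by simp
  moreover have "of_bool (a \<in> abs ` set (x # y # zs))
      = (of_bool (\<bar>x\<bar> = a) + of_bool (a \<in> abs ` set (y # zs)) :: nat)"
  proof (cases "\<bar>x\<bar> = a")
    case True
    moreover have "\<bar>x\<bar> \<notin> abs ` set (y # zs)" using "1.prems"(1) by simp
    ultimately show ?thesis by auto
  next
    case False
    then have "a \<in> abs ` set (x # y # zs) \<longleftrightarrow> a \<in> abs ` set (y # zs)" by auto
    then show ?thesis using False by simp
  qed
  moreover have "map (swap_abs a) (expand a (x # y # zs)) = ?d @ ?r" by simp
  ultimately show ?case by (simp del: list.set expand_simps)
next
  case ("2_2" x)
  have "(a = \<bar>x\<bar>) = (\<bar>x\<bar> = a)" by blast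
  then show ?case
    using descents_swap_double_letter_append[OF assms(1), of x "[]"] by simp
qed simp

lemma filter_less_expand:
  assumes "b \<le> a" and "0 \<notin> set w"
  shows "filter (\<lambda>y. y < b) (map abs (expand a w)) = filter (\<lambda>y. y < b) (map abs w)"
  using assms(2)
proof (induction w)
  case (Cons x xs)
  then have "filter (\<lambda>y. y < b) (map abs (double_letter a x)) = filter (\<lambda>y. y < b) [\<bar>x\<bar>]"
    using assms(1) by (subst map_abs_double_letter) auto
  moreover have "filter (\<lambda>y. y < b) (map abs (expand a xs)) = filter (\<lambda>y. y < b) (map abs xs)"
    using Cons by simp
  ultimately show ?case by (simp del: filter_map)
qed simp

lemma expand_low:
  assumes "0 \<notin> set w" and "a \<notin> abs ` set w"
  shows "filter (\<lambda>y. y \<le> a + 1) (map abs (expand a w)) = filter (\<lambda>y. y \<le> a - 1) (map abs w)"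
  using assms
proof (induction w)
  case (Cons x xs)
  then have "filter (\<lambda>y. y \<le> a + 1) (map abs (double_letter a x)) = filter (\<lambda>y. y \<le> a - 1) [\<bar>x\<bar>]"
    by (subst map_abs_double_letter) auto
  moreover have "filter (\<lambda>y. y \<le> a + 1) (map abs (expand a xs)) = filter (\<lambda>y. y \<le> a - 1) (map abs xs)"
    using Cons by simp
  ultimately show ?case by (simp del: filter_map)
qed simp

text \<open>
  The two letters of the block are adjacent both in position and in value, so they have the same
  inversions with every other letter and contribute an even number. The letters larger than \<open>a\<close> are outside the count
  on both sides.
\<close>

lemma even_low_inv_expand:
  assumes "0 \<notin> set w" and "distinct (map abs w)"
  shows "even (low_inv (a + 1) (expand a w) + low_inv (a - 1) w)"
  using assms
proof (induction w)
  case (Cons x xs)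
  let ?R = "filter (\<lambda>y. y \<le> a - 1) (map abs xs)" and ?R' = "filter (\<lambda>y. y \<le> a + 1) (map abs (expand a xs))"
  have block: "map abs (double_letter a x)
      = (if \<bar>x\<bar> < a then [\<bar>x\<bar>] else if \<bar>x\<bar> = a then [a, a + 1] else [\<bar>x\<bar> + 1])"
    using Cons.prems by (intro map_abs_double_letter) auto
  have low: "low_inv (a + 1) (expand a (x # xs))
      = inv_count (filter (\<lambda>y. y \<le> a + 1) (map abs (double_letter a x)) @ ?R')"
    by (simp add: low_inv_def del: filter_map)
  have IH: "even (inv_count ?R' + inv_count ?R)" using Cons by (simp add: low_inv_def)
  consider "\<bar>x\<bar> < a" | "\<bar>x\<bar> = a" | "\<bar>x\<bar> > a" by linarith
  then show ?case
  proof cases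
    case 1
    have "filter (\<lambda>y. y < \<bar>x\<bar>) ?R' = filter (\<lambda>y. y < \<bar>x\<bar>) (map abs (expand a xs))"
      "filter (\<lambda>y. y < \<bar>x\<bar>) ?R = filter (\<lambda>y. y < \<bar>x\<bar>) (map abs xs)"
      unfolding filter_filter using 1 by (auto intro!: filter_cong)
    then have "filter (\<lambda>y. y < \<bar>x\<bar>) ?R' = filter (\<lambda>y. y < \<bar>x\<bar>) ?R"
      using filter_less_expand[of "\<bar>x\<bar>" a xs] 1 Cons.prems by simp
    then show ?thesis using IH 1 unfolding low block by (simp add: low_inv_def del: filter_map filter_filter)
  next
    case 2
    define R where "R = ?R"
    have R: "?R' = R"
      unfolding R_def by (rule expand_low) (use Cons.prems 2 in auto)
    have "low_inv (a + 1) (expand a (x # xs)) = inv_count (a # (a + 1) # R)"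
      unfolding low block R using 2 by simp
    moreover have "low_inv (a - 1) (x # xs) = inv_count R"
      using 2 by (simp add: low_inv_def R_def)
    moreover have "filter (\<lambda>y. y < a) R = R" "filter (\<lambda>y. y < a + 1) R = R"
      by (rule filter_True, simp add: R_def)+
    ultimately show ?thesis by auto
  next
    case 3
    then show ?thesis using IH unfolding low block by (simp add: low_inv_def del: filter_map)
  qed
qed (simp add: low_inv_def)

section \<open>Collapsing one pair of letters\<close>

definition low_sum :: "'a::comm_ring_1 \<Rightarrow> nat \<Rightarrow> int \<Rightarrow> 'a" where
  "low_sum t N j = (\<Sum>w \<in> last_pos_perms N. (-1) ^ low_inv j w * t ^ fdes w)"

lemma last_pos_permsD:
  assumes "w \<in> last_pos_perms N"
  shows "length w = N" and "abs ` set w = {1..int N}" and "distinct (map abs w)"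
    and "0 \<notin> set w" and "0 < last w"
proof -
  show *: "abs ` set w = {1..int N}" and "length w = N" "distinct (map abs w)" "0 < last w"
    using assms by (auto simp: last_pos_perms_def signed_perms_def)
  show "0 \<notin> set w"
  proof
    assume "0 \<in> set w"
    then have "\<bar>0\<bar> \<in> {1..int N}" unfolding *[symmetric] by (rule imageI)
    then show False by simp
  qed
qed

lemma last_pos_permsI:
  "length w = N \<Longrightarrow> abs ` set w = {1..int N} \<Longrightarrow> 0 < last w \<Longrightarrow> w \<in> last_pos_perms N"
  by (simp add: last_pos_perms_def signed_perms_iff)

lemma swap_abs_last_pos_perms:
  assumes "1 \<le> a" and "a < int N" and "w \<in> last_pos_perms N"
  shows "map (swap_abs a) w \<in> last_pos_perms N"
proof (rule last_pos_permsI)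
  note w = last_pos_permsD[OF assms(3)]
  show "length (map (swap_abs a) w) = N" using w by simp
  have "w \<noteq> []" using w(1) assms(1,2) by auto
  then show "0 < last (map (swap_abs a) w)"
    using w(5) assms(1) by (simp add: last_map swap_abs_greater_0)
  have bound: "swap_abs a z \<in> {1..int N}" if "z \<in> {1..int N}" for z
    using that assms(1,2) by (auto simp: swap_abs_pos)
  have "abs ` set (map (swap_abs a) w) = swap_abs a ` (abs ` set w)"
    using assms(1) by (simp add: image_image abs_swap_abs)
  also have "\<dots> = {1..int N}"
  proof
    show "swap_abs a ` abs ` set w \<subseteq> {1..int N}"
      unfolding w(2) using bound by blast
    show "{1..int N} \<subseteq> swap_abs a ` abs ` set w"
    proof
      fix z assume "z \<in> {1..int N}"
      then show "z \<in> swap_abs a ` abs ` set w"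
        unfolding w(2) using bound swap_abs_swap_abs[OF assms(1), of z]
        by (intro image_eqI[of _ _ "swap_abs a z"]) simp_all
    qed
  qed
  finally show "abs ` set (map (swap_abs a) w) = {1..int N}" .
qed

lemma length_expand:
  assumes "distinct (map abs w)"
  shows "length (expand a w) = length w + of_bool (a \<in> abs ` set w)"
  using assms
proof (induction w)
  case (Cons x xs)
  have "length (double_letter a x) = Suc (of_bool (\<bar>x\<bar> = a))"
    by (simp add: double_letter_def)
  moreover have "\<bar>x\<bar> = a \<Longrightarrow> a \<notin> abs ` set xs"
    using Cons.prems by auto
  moreover have "length (expand a xs) = length xs + of_bool (a \<in> abs ` set xs)"
    using Cons by simp
  ultimately show ?case by (cases "\<bar>x\<bar> = a") auto
qed simp

lemma abs_set_expand:
  assumes "1 \<le> a" and "0 \<notin> set w"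
  shows "abs ` set (expand a w) =
    {z \<in> abs ` set w. z \<le> a} \<union> (\<lambda>z. z + 1) ` {z \<in> abs ` set w. a \<le> z}"
  using assms(2)
proof (induction w)
  case (Cons x xs)
  have "\<bar>x + sgn x\<bar> = \<bar>x\<bar> + 1" using Cons.prems by (intro abs_add_sgn) auto
  then have "abs ` set (double_letter a x) =
      {z \<in> {\<bar>x\<bar>}. z \<le> a} \<union> (\<lambda>z. z + 1) ` {z \<in> {\<bar>x\<bar>}. a \<le> z}"
    unfolding double_letter_def by (cases "\<bar>x\<bar> < a"; cases "\<bar>x\<bar> = a") auto
  moreover have "{z \<in> abs ` set (x # xs). P z} = {z \<in> {\<bar>x\<bar>}. P z} \<union> {z \<in> abs ` set xs. P z}" for P
    by auto
  ultimately show ?case using Cons by (simp only: expand_simps set_append image_Un) auto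
qed simp

lemma expand_last_pos_perms:
  assumes "1 \<le> a" and "a \<le> int N" and "w \<in> last_pos_perms N"
  shows "expand a w \<in> last_pos_perms (Suc N)"
proof (rule last_pos_permsI)
  note w = last_pos_permsD[OF assms(3)]
  show "length (expand a w) = Suc N"
    using length_expand[OF w(3), of a] w(1,2) assms by simp
  have "w \<noteq> []" using w(1) assms(1,2) by auto
  then show "0 < last (expand a w)" using w(5) assms(1) by (simp add: last_expand_greater_0)
  have "{z \<in> {1..int N}. z \<le> a} = {1..a}" "{z \<in> {1..int N}. a \<le> z} = {a..int N}"
    using assms by auto
  moreover have "(\<lambda>z. z + 1) ` {a..int N} = {a + 1..int N + 1}"
    by (rule image_add_atLeastAtMost')
  ultimately show "abs ` set (expand a w) = {1..int (Suc N)}"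
    unfolding abs_set_expand[OF assms(1) w(4)] w(2) using assms by auto
qed

lemma distinct_map_neighbours:
  "distinct (map f (u @ x # y # v)) \<Longrightarrow> z \<in> set u \<union> set v \<Longrightarrow> f z \<noteq> f x \<and> f z \<noteq> f y"
  by simp (metis imageI)

lemma abs_set_squeeze:
  assumes "1 \<le> a"
  shows "abs ` set (squeeze a w) = (\<lambda>z. if z > a then z - 1 else z) ` (abs ` set w - {a + 1})"
proof -
  have shift: "\<bar>if \<bar>x\<bar> > a then x - sgn x else x\<bar> = (if \<bar>x\<bar> > a then \<bar>x\<bar> - 1 else \<bar>x\<bar>)" for x
    using assms by (cases "x > 0") simp_all
  have "abs ` set (squeeze a w)
      = (\<lambda>x. if \<bar>x\<bar> > a then \<bar>x\<bar> - 1 else \<bar>x\<bar>) ` {x \<in> set w. \<bar>x\<bar> \<noteq> a + 1}"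
    by (simp only: squeeze_def set_map set_filter image_image shift)
  also have "\<dots> = (\<lambda>z. if z > a then z - 1 else z) ` (abs ` {x \<in> set w. \<bar>x\<bar> \<noteq> a + 1})"
    by (simp only: image_image)
  also have "abs ` {x \<in> set w. \<bar>x\<bar> \<noteq> a + 1} = abs ` set w - {a + 1}"
    by auto
  finally show ?thesis .
qed

lemma squeeze_last_pos_perms:
  assumes "1 \<le> a" and "a \<le> int N" and "w \<in> last_pos_perms (Suc N)"
    and w: "w = u @ x # (x + sgn x) # v" and "\<bar>x\<bar> = a"
  shows "squeeze a w \<in> last_pos_perms N" and "expand a (squeeze a w) = w"
proof -
  note W = last_pos_permsD[OF assms(3)]
  have y: "\<bar>x + sgn x\<bar> = a + 1" "0 < x + sgn x \<longleftrightarrow> 0 < x"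
    using assms(1,5) by (auto simp: sgn_if)
  have rest: "\<forall>z \<in> set u \<union> set v. \<bar>z\<bar> \<noteq> a \<and> \<bar>z\<bar> \<noteq> a + 1"
    using distinct_map_neighbours[of abs u x "x + sgn x" v] W(3) y(1) assms(5) unfolding w by simp
  show "expand a (squeeze a w) = w"
    unfolding w by (rule expand_squeeze_block[OF assms(1,5) rest])
  show "squeeze a w \<in> last_pos_perms N"
  proof (rule last_pos_permsI)
    have "filter (\<lambda>z. \<bar>z\<bar> \<noteq> a + 1) w = u @ x # v"
      unfolding w using rest y(1) assms(5) by (simp add: filter_id_conv)
    then have sq: "squeeze a w = map (\<lambda>x. if \<bar>x\<bar> > a then x - sgn x else x) (u @ x # v)"
      by (simp add: squeeze_def)
    have "length (squeeze a w) = length (u @ x # v)" unfolding sq by (rule length_map)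
    then show "length (squeeze a w) = N" using W(1) w by simp
    then have "squeeze a w \<noteq> []" using assms(1,2) by auto
    then show "0 < last (squeeze a w)"
      using W(5) last_expand_greater_0[OF assms(1)] \<open>expand a (squeeze a w) = w\<close> by metis
    show "abs ` set (squeeze a w) = {1..int N}"
      unfolding abs_set_squeeze[OF assms(1)] W(2)
    proof
      show "(\<lambda>z. if z > a then z - 1 else z) ` ({1..int (Suc N)} - {a + 1}) \<subseteq> {1..int N}"
        using assms(1,2) by auto
      show "{1..int N} \<subseteq> (\<lambda>z. if z > a then z - 1 else z) ` ({1..int (Suc N)} - {a + 1})"
      proof
        fix z assume "z \<in> {1..int N}"
        then show "z \<in> (\<lambda>z. if z > a then z - 1 else z) ` ({1..int (Suc N)} - {a + 1})"
          by (intro image_eqI[of _ _ "if z \<le> a then z else z + 1"]) auto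
      qed
    qed
  qed
qed

text \<open>
  This chooses one word from each pair of words that are related by the exchange of \<open>a\<close> and \<open>a + 1\<close>. The
  definition is meant for words in which the absolute value \<open>a\<close> occurs.
\<close>

definition precedes :: "int \<Rightarrow> int list \<Rightarrow> bool" where
  "precedes a w \<longleftrightarrow> a + 1 \<notin> abs ` set (takeWhile (\<lambda>x. \<bar>x\<bar> \<noteq> a) w)"

lemma precedes_Cons:
  "precedes a (x # xs) \<longleftrightarrow> \<bar>x\<bar> = a \<or> \<bar>x\<bar> \<noteq> a + 1 \<and> precedes a xs"
  unfolding precedes_def by (cases "\<bar>x\<bar> = a"; cases "\<bar>x\<bar> = a + 1") simp_all

lemma precedes_swap_abs:
  assumes "1 \<le> a" and "a \<in> abs ` set w"
  shows "precedes a (map (swap_abs a) w) \<longleftrightarrow> \<not> precedes a w"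
  using assms(2)
proof (induction w)
  case (Cons x xs)
  have abs: "\<bar>swap_abs a x\<bar> = (if \<bar>x\<bar> = a then a + 1 else if \<bar>x\<bar> = a + 1 then a else \<bar>x\<bar>)"
    using assms(1) by (simp add: abs_swap_abs swap_abs_pos)
  consider "\<bar>x\<bar> = a" | "\<bar>x\<bar> = a + 1" | "\<bar>x\<bar> \<noteq> a" "\<bar>x\<bar> \<noteq> a + 1" by blast
  then show ?case
  proof cases
    case 3
    then have "a \<in> abs ` set xs" using Cons.prems by auto
    then have "precedes a (map (swap_abs a) xs) \<longleftrightarrow> \<not> precedes a xs" by (rule Cons.IH)
    then show ?thesis using 3 abs by (simp add: precedes_Cons)
  qed (use abs in \<open>simp_all add: precedes_Cons\<close>)
qed simp

text \<open>
  The absolute value \<open>a + 1\<close> occurs in an expansion only as the second letter of the block.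
\<close>

lemma precedes_expand:
  assumes "1 \<le> a" and "0 \<notin> set w"
  shows "precedes a (expand a w)"
  using assms(2)
proof (induction w)
  case Nil
  then show ?case by (simp add: precedes_def)
next
  case (Cons x xs)
  then have "\<bar>x + sgn x\<bar> = \<bar>x\<bar> + 1" by (intro abs_add_sgn) auto
  then show ?case using Cons by (simp add: double_letter_def precedes_Cons)
qed

lemma not_precedes:
  assumes "\<bar>x\<bar> = a + 1" "\<bar>y\<bar> = a" "distinct (map abs (u @ x # y # v))"
  shows "\<not> precedes a (u @ x # y # v)"
proof -
  have "\<forall>z \<in> set (u @ [x]). \<bar>z\<bar> \<noteq> a"
    using distinct_map_neighbours[OF assms(3)] assms(1,2) by simp
  then have "takeWhile (\<lambda>z. \<bar>z\<bar> \<noteq> a) ((u @ [x]) @ y # v) = u @ [x]"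
    using assms(2) by (subst takeWhile_append2) auto
  then show ?thesis using assms(1) by (auto simp: precedes_def)
qed

text \<open>
  Each word in which \<open>a\<close> precedes \<open>a + 1\<close> is summed together with its image under the exchange. The
  two terms cancel unless the word is an expansion of a shorter word.
\<close>

lemma low_sum_step:
  fixes t :: "'a::comm_ring_1"
  assumes "1 \<le> a" and "a \<le> int N"
  shows "low_sum t (Suc N) (a + 1) = (1 - t\<^sup>2) * low_sum t N (a - 1)"
proof -
  let ?W = "last_pos_perms (Suc N)" and ?\<phi> = "map (swap_abs a)"
  define f where "f w = (-1) ^ low_inv (a + 1) w * t ^ fdes w" for w
  define P where "P = {w \<in> ?W. precedes a w}"
  define E where "E = expand a ` last_pos_perms N"
  have fin: "finite P" by (simp add: P_def finite_last_pos_perms)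
  have inv: "?\<phi> (?\<phi> w) = w" for w
    using assms(1) by (simp add: o_def swap_abs_swap_abs)
  have \<phi>W: "?\<phi> w \<in> ?W" if "w \<in> ?W" for w
    using swap_abs_last_pos_perms[of a "Suc N"] assms that by simp
  have letters: "a \<in> abs ` set w" "a + 1 \<in> abs ` set w" if "w \<in> ?W" for w
    using last_pos_permsD(2)[OF that] assms by auto
  have sign: "(-1) ^ low_inv (a + 1) (?\<phi> w) = (- ((-1) ^ low_inv (a + 1) w) :: 'a)" if "w \<in> ?W" for w
  proof -
    have "odd (low_inv (a + 1) w + low_inv (a + 1) (?\<phi> w))"
      using odd_low_inv_swap_abs[OF assms(1)] last_pos_permsD[OF that] letters[OF that] by blast
    then show ?thesis by (cases "even (low_inv (a + 1) w)") auto
  qed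
  have fdes_swap: "fdes (?\<phi> w) = 2 * descents (?\<phi> w) + of_bool (hd w < 0)" if "w \<in> ?W" for w
  proof -
    have "w \<noteq> []" using last_pos_permsD(1)[OF that] by auto
    then show ?thesis using assms(1) by (simp add: fdes_eq hd_map swap_abs_less_0)
  qed
  have "E \<subseteq> ?W"
    unfolding E_def using expand_last_pos_perms[OF assms] by blast
  then have EP: "E \<subseteq> P"
    using precedes_expand[OF assms(1)] last_pos_permsD(4) unfolding P_def E_def by blast
  \<comment> \<open>An expansion and its image differ by a sign and one descent, which \<open>fdes\<close> counts twice.\<close>
  have inE: "f w + f (?\<phi> w) = (1 - t\<^sup>2) * f w" if "w \<in> E" for w
  proof -
    obtain v where v: "v \<in> last_pos_perms N" "w = expand a v" using \<open>w \<in> E\<close> by (auto simp: E_def)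
    note V = last_pos_permsD[OF v(1)]
    have "w \<in> ?W" using \<open>w \<in> E\<close> \<open>E \<subseteq> ?W\<close> by blast
    have "descents (?\<phi> w) = descents w + 1"
      using descents_expand[OF assms(1) V(3,4)] descents_swap_expand[OF assms(1) V(3,4)] V(2) assms
      by (simp add: v(2))
    then have "fdes (?\<phi> w) = fdes w + 2"
      using fdes_swap[OF \<open>w \<in> ?W\<close>] by (simp add: fdes_eq[of w])
    then show ?thesis
      using sign[OF \<open>w \<in> ?W\<close>] 
        by (simp add: f_def power_add left_diff_distrib right_diff_distrib power2_eq_square mult_ac)
  qed
  \<comment> \<open>A change in the number of descents would exhibit \<open>w\<close> as an expansion.\<close>
  have notE: "f w + f (?\<phi> w) = 0" if "w \<in> P - E" for w
  proof -
    have w: "w \<in> ?W" "precedes a w" using that by (auto simp: P_def)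
    note W = last_pos_permsD[OF w(1)]
    have "descents (?\<phi> w) = descents w"
    proof (rule ccontr)
      assume "descents (?\<phi> w) \<noteq> descents w"
      then obtain u x y v where uv: "w = u @ x # y # v" "exchanged a x y"
        using descents_swap_abs_neqD[OF assms(1)] by blast
      have "\<not> (\<bar>x\<bar> = a + 1 \<and> \<bar>y\<bar> = a)"
        using not_precedes[of x a y u v] W(3) w(2) uv(1) by blast
      then have xy: "\<bar>x\<bar> = a" "y = x + sgn x"
        using uv(2) assms(1) by (auto simp: exchanged_def sgn_if)
      have "w = expand a (squeeze a w)" "squeeze a w \<in> last_pos_perms N"
        using squeeze_last_pos_perms[OF assms w(1) _ xy(1)] uv(1) xy(2) by metis+
      then show False using that unfolding E_def by blast
    qed
    then show ?thesis using sign[OF w(1)] fdes_swap[OF w(1)] by (simp add: f_def fdes_eq)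
  qed
  have "low_sum t (Suc N) (a + 1) = sum f P + sum f (?W - P)"
    unfolding low_sum_def f_def[symmetric]
    by (rule sum.subset_diff[THEN trans[OF _ add.commute]]) (auto simp: P_def finite_last_pos_perms)
  also have "sum f (?W - P) = (\<Sum>w \<in> P. f (?\<phi> w))"
    by (rule sum.reindex_bij_witness[of _ ?\<phi> ?\<phi>])
      (use inv \<phi>W precedes_swap_abs[OF assms(1)] letters(1) in \<open>auto simp: P_def simp del: map_map\<close>)
  also have "sum f P + (\<Sum>w \<in> P. f (?\<phi> w)) = (\<Sum>w \<in> P. f w + f (?\<phi> w))"
    by (simp add: sum.distrib)
  also have "\<dots> = (\<Sum>w \<in> E. f w + f (?\<phi> w))"
    by (rule sum.mono_neutral_right) (use fin EP notE in auto)
  also have "\<dots> = (1 - t\<^sup>2) * sum f E"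
    using inE by (simp add: sum_distrib_left)
  also have "sum f E = (\<Sum>w \<in> last_pos_perms N. f (expand a w))"
    unfolding E_def
    by (subst sum.reindex) (auto intro: inj_on_inverseI[where g = "squeeze a"] simp: squeeze_expand assms(1))
  also have "\<dots> = low_sum t N (a - 1)"
    unfolding low_sum_def
  proof (rule sum.cong[OF refl])
    fix w assume "w \<in> last_pos_perms N"
    note W = last_pos_permsD[OF this]
    have "w \<noteq> []" using W(1) assms by auto
    then have "fdes (expand a w) = fdes w"
      using descents_expand[OF assms(1) W(3,4)] assms(1) by (simp add: fdes_eq hd_expand_less_0)
    moreover have "even (low_inv (a + 1) (expand a w) + low_inv (a - 1) w)"
      by (rule even_low_inv_expand[OF W(4,3)])
    then have "(-1) ^ low_inv (a + 1) (expand a w) = ((-1) ^ low_inv (a - 1) w :: 'a)"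
      by (cases "even (low_inv (a - 1) w)") auto
    ultimately show "f (expand a w) = (-1) ^ low_inv (a - 1) w * t ^ fdes w"
      by (simp add: f_def)
  qed
  finally show ?thesis .
qed

section \<open>Collapsing all pairs\<close>

text \<open>
  The \<open>k\<close>-th step collapses the pair \<open>(2 k, 2 k + 1)\<close> of a word with \<open>n + 1 + k\<close> letters, where
  the letters above \<open>2 k + 1\<close> are the \<open>n - k\<close> blocks collapsed before. The
  induction runs through these steps backwards.
\<close>

lemma low_sum_all_pairs:
  fixes t :: "'a::comm_ring_1"
  assumes "k \<le> n"
  shows "low_sum t (n + 1 + k) (2 * int k + 1) = (1 - t\<^sup>2) ^ k * low_sum t (n + 1) 1"
  using assms
proof (induction k)
  case (Suc k)
  have "low_sum t (Suc (n + 1 + k)) ((2 * int k + 2) + 1)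
      = (1 - t\<^sup>2) * low_sum t (n + 1 + k) ((2 * int k + 2) - 1)"
    using Suc.prems by (intro low_sum_step) auto
  then show ?case using Suc by (simp add: algebra_simps)
qed simp

theorem theorem3:
  fixes n :: nat and t :: "int poly"
  assumes "n \<ge> 1"
    and "t = [:0, 1:]"
  shows "(\<Sum>w \<in> even_signed_perms (2 * n + 1). (-1) ^ nat (length_D w) * t ^ ddes w) =
         (1 - t ^ 2) ^ n * (\<Sum>w \<in> even_signed_perms (n + 1). t ^ ddes w)"
proof -
  have "(\<Sum>w \<in> even_signed_perms (2 * n + 1). (-1) ^ nat (length_D w) * t ^ ddes w)
      = (\<Sum>w \<in> even_signed_perms (2 * n + 1). (-1) ^ inv_count (map abs w) * t ^ ddes w)"
    by (rule sum.cong) (auto simp: even_signed_perms_def sign_length_D)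
  also have "\<dots> = (\<Sum>w \<in> last_pos_perms (2 * n + 1). (-1) ^ inv_count (map abs w) * t ^ fdes w)"
    by (rule sum_even_signed_perms) simp
  also have "\<dots> = low_sum t (2 * n + 1) (2 * int n + 1)"
    unfolding low_sum_def
  proof (rule sum.cong[OF refl])
    fix w assume "w \<in> last_pos_perms (2 * n + 1)"
    then have "set (map abs w) = {1..int (2 * n + 1)}"
      unfolding set_map by (rule last_pos_permsD)
    then have "\<forall>y \<in> set (map abs w). y \<le> 2 * int n + 1" by simp
    then have "filter (\<lambda>y. y \<le> 2 * int n + 1) (map abs w) = map abs w" by (rule filter_True)
    then show "(-1) ^ inv_count (map abs w) * t ^ fdes w = (-1) ^ low_inv (2 * int n + 1) w * t ^ fdes w"
      by (simp add: low_inv_def)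
  qed
  also have "\<dots> = (1 - t\<^sup>2) ^ n * low_sum t (n + 1) 1"
  proof -
    have "n + 1 + n = 2 * n + 1" by simp
    from low_sum_all_pairs[OF order_refl[of n], of t, unfolded this] show ?thesis .
  qed
  also have "low_sum t (n + 1) 1 = (\<Sum>w \<in> last_pos_perms (n + 1). t ^ fdes w)"
    unfolding low_sum_def
  proof (rule sum.cong[OF refl])
    fix w assume "w \<in> last_pos_perms (n + 1)"
    note W = last_pos_permsD[OF this]
    let ?l = "filter (\<lambda>y. y \<le> 1) (map abs w)"
    \<comment> \<open>The letter of absolute value 1 alone has no inversions.\<close>
    have "distinct ?l" "set ?l \<subseteq> {1}" using W(2,3) by auto
    then have "length ?l \<le> 1"
      using card_mono[of "{1}" "set ?l"] distinct_card[of ?l] by (simp del: filter_map set_filter)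
    then have "low_inv 1 w = 0"
      unfolding low_inv_def by (cases ?l) auto
    then show "(-1) ^ low_inv 1 w * t ^ fdes w = t ^ fdes w" by simp
  qed
  also have "\<dots> = (\<Sum>w \<in> even_signed_perms (n + 1). t ^ ddes w)"
    using sum_even_signed_perms[of "n + 1" "\<lambda>_. 1" t] by simp
  finally show ?thesis by simp
qed

end
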